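(* Let $G$ be a connected graph and let $0\le\varepsilon<1$ be a constant. Let $q>0$ and $p\ge 0$ be two integers. Let $C_1>0$ and $C_2$ be two real constants such that (1) $W_1(\mu_x^\varepsilon,\mu_y^\varepsilon)\le q-C_1$ for any two vertices $x,y$ with ${\rm d}(x,y)=q$; (2) $W_1(\mu_x^1,\mu_y^\varepsilon)\le p+C_2$ for any two vertices $x,y$ with ${\rm d}(x,y)=p$. Then $G$ is finite, with diameter $d$ satisfying $$d\le 2p-1+\max\left\{0,\left(\left\lfloor\frac{2C_2}{C_1}\right\rfloor+1\right)q\right\}.$$
   Context: Graphs $G=(V,E)$ are simple, undirected and locally finite (possibly with infinitely many vertices), and every vertex has at least one neighbor; ${\rm d}(x,y)$ is the graph distance, $x\sim y$ means adjacency, and $k_x$ is the valency (degree) of $x$. For $\varepsilon\in[0,1]$ and $x\in V$, $\mu_x^\varepsilon$ is the probability measure on $V$ with $\mu_x^\varepsilon(x)=\varepsilon$, $\mu_x^\varepsilon(y)=\frac{1-\varepsilon}{k_x}$ if $y\sim x$, and $\mu_x^\varepsilon(y)=0$ otherwise (so $\mu_x^1$ is the Dirac measure at $x$). For probability measures $\mu_1,\mu_2$ on $V$, the Wasserstein distance is $W_1(\mu_1,\mu_2)=\inf_\pi\sum_{y\in V}\sum_{x\in V}{\rm d}(x,y)\pi(x,y)$, where the infimum is over all maps $\pi:V\times V\to[0,1]$ satisfying $\mu_1(x)=\sum_{y\in V}\pi(x,y)$ and $\mu_2(y)=\sum_{x\in V}\pi(x,y)$ for all $x,y\in V$. *)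

theory Defs
  imports "HOL-Probability.Probability" "Graph_Theory.Graph_Theory"
begin

text \<open>
  An undirected graph is a symmetric digraph, so every edge is present as the two arcs
  \<open>(x, y)\<close> and \<open>(y, x)\<close>; the arcs leaving a vertex correspond to its neighbours, and the
  out-degree is the valency.
\<close>

locale locally_finite_graph = pair_bidirected_digraph G for G :: "'a pair_pre_digraph" +
  assumes finite_out_arcs: "x \<in> pverts G \<Longrightarrow> finite (out_arcs (with_proj G) x)"
    and out_arcs_nonempty: "x \<in> pverts G \<Longrightarrow> out_arcs (with_proj G) x \<noteq> {}"

definition graph_dist :: "'a pair_pre_digraph \<Rightarrow> 'a \<Rightarrow> 'a \<Rightarrow> ereal" where
  "graph_dist G x y = wf_digraph.\<mu> (with_proj G) (\<lambda>_. 1) x y"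

definition graph_diameter :: "'a pair_pre_digraph \<Rightarrow> ereal" where
  "graph_diameter G = (SUP x\<in>pverts G. SUP y\<in>pverts G. graph_dist G x y)"

text \<open>
  The measure \<open>\<mu>\<^sub>x\<^sup>\<epsilon>\<close>. It is only meaningful for a vertex \<open>x\<close> of a locally finite graph and
  \<open>0 \<le> \<epsilon> \<le> 1\<close>; see \<open>pmf_lazy_step\<close>.
\<close>

definition lazy_step :: "'a pair_pre_digraph \<Rightarrow> real \<Rightarrow> 'a \<Rightarrow> 'a pmf" where
  "lazy_step G \<epsilon> x = embed_pmf (\<lambda>y.
     if y = x then \<epsilon>
     else if (x, y) \<in> parcs G then (1 - \<epsilon>) / real (out_degree (with_proj G) x)
     else 0)"

definition transport_plans :: "'a set \<Rightarrow> 'a pmf \<Rightarrow> 'a pmf \<Rightarrow> ('a \<Rightarrow> 'a \<Rightarrow> real) set" where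
  "transport_plans V \<mu>1 \<mu>2 = {\<pi>.
     (\<forall>x\<in>V. \<forall>y\<in>V. 0 \<le> \<pi> x y \<and> \<pi> x y \<le> 1) \<and>
     (\<forall>x\<in>V. ((\<lambda>y. \<pi> x y) has_sum pmf \<mu>1 x) V) \<and>
     (\<forall>y\<in>V. ((\<lambda>x. \<pi> x y) has_sum pmf \<mu>2 y) V)}"

text \<open>
  Costs are summed in \<open>ennreal\<close>, where every sum exists. The result is an \<open>ereal\<close> so that it can
  be compared with bounds that may be negative.
\<close>

definition W1 :: "'a pair_pre_digraph \<Rightarrow> 'a pmf \<Rightarrow> 'a pmf \<Rightarrow> ereal" where
  "W1 G \<mu>1 \<mu>2 = enn2ereal (INF \<pi>\<in>transport_plans (pverts G) \<mu>1 \<mu>2.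
     \<Sum>\<^sub>\<infinity>y\<in>pverts G. \<Sum>\<^sub>\<infinity>x\<in>pverts G. e2ennreal (graph_dist G x y) * ennreal (\<pi> x y))"

context locally_finite_graph
begin

lemma pmf_lazy_step:
  assumes x: "x \<in> pverts G" and \<epsilon>: "0 \<le> \<epsilon>" "\<epsilon> \<le> 1"
  shows "pmf (lazy_step G \<epsilon> x) y =
     (if y = x then \<epsilon>
      else if (x, y) \<in> parcs G then (1 - \<epsilon>) / real (out_degree (with_proj G) x)
      else 0)"
proof -
  define N where "N = {y. (x, y) \<in> parcs G}"
  define f where "f = (\<lambda>y. if y = x then \<epsilon>
      else if (x, y) \<in> parcs G then (1 - \<epsilon>) / real (out_degree (with_proj G) x) else 0)"
  have oa: "out_arcs (with_proj G) x = Pair x ` N"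
    by (auto simp: out_arcs_def N_def)
  have fin: "finite N"
    using finite_out_arcs[OF x] unfolding oa by (simp add: finite_image_iff inj_on_def)
  have ne: "N \<noteq> {}" using out_arcs_nonempty[OF x] oa by simp
  have deg: "out_degree (with_proj G) x = card N"
    unfolding out_degree_def oa by (simp add: card_image inj_on_def)
  have xN: "x \<notin> N" using pair_no_loops[of "(x, x)"] by (auto simp: N_def)
  have nonneg: "0 \<le> f y" for y using \<epsilon> by (auto simp: f_def)
  have "(\<integral>\<^sup>+y. ennreal (f y) \<partial>count_space UNIV) = (\<Sum>y\<in>insert x N. ennreal (f y))"
    by (intro nn_integral_count_space') (use fin in \<open>auto simp: f_def N_def\<close>)
  also have "\<dots> = ennreal (\<Sum>y\<in>insert x N. f y)"
    using nonneg by (simp add: sum_ennreal)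
  also have "(\<Sum>y\<in>insert x N. f y) = \<epsilon> + (\<Sum>y\<in>N. (1 - \<epsilon>) / real (card N))"
    unfolding sum.insert[OF fin xN] using xN
    by (intro arg_cong2[where f = "(+)"] sum.cong) (auto simp: f_def N_def deg[unfolded N_def])
  also have "\<dots> = 1" using fin ne by simp
  finally have "(\<integral>\<^sup>+y. ennreal (f y) \<partial>count_space UNIV) = 1" by simp
  then have "pmf (embed_pmf f) y = f y" by (intro pmf_embed_pmf nonneg)
  then show ?thesis by (simp add: lazy_step_def f_def)
qed

end

end

theory Submission
  imports Defs
begin

text \<open>
  A function \<open>f\<close> that is 1-Lipschitz for the graph distance satisfies
  \<open>E\<^sub>\<mu> f - E\<^sub>\<nu> f \<le> W\<^sub>1(\<mu>, \<nu>)\<close>, the easy half of Kantorovich duality. Suppose that some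
  \<open>x\<close> and \<open>y\<close> have distance exactly \<open>2p + nq\<close>, where \<open>n = max 0 (\<lfloor>2C\<^sub>2/C\<^sub>1\<rfloor> + 1)\<close>. On a geodesic
  from \<open>x\<close> to \<open>y\<close> take \<open>u\<close> at distance \<open>p\<close> from \<open>x\<close>, \<open>v\<close> at distance \<open>p\<close> from \<open>y\<close>, and
  further points that cut the stretch from \<open>u\<close> to \<open>v\<close> into \<open>n\<close> pieces of length \<open>q\<close>.
  Telescoping the expectations of the distance to \<open>y\<close> along
  \<open>\<mu>\<^sub>x\<^sup>1, \<mu>\<^sub>u\<^sup>\<epsilon>, \<dots>, \<mu>\<^sub>v\<^sup>\<epsilon>, \<mu>\<^sub>y\<^sup>1\<close> gives \<open>2p + nq \<le> 2(p + C\<^sub>2) + n(q - C\<^sub>1)\<close>, so \<open>n \<le> 2C\<^sub>2/C\<^sub>1\<close>,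
  which contradicts the choice of \<open>n\<close>. Using expectations instead of the triangle inequality for
  \<open>W\<^sub>1\<close> avoids gluing transport plans. Since geodesics realise every smaller distance, all
  distances are then below \<open>2p + nq\<close>, and balls in a locally finite graph are finite.
\<close>

lemma sum_le_infsum_ennreal:
  fixes f :: "'a \<Rightarrow> ennreal"
  assumes "finite S" "S \<subseteq> A"
  shows "sum f S \<le> infsum f A"
proof -
  have "infsum f S \<le> infsum f A"
    using assms(2) by (intro infsum_mono_neutral nonneg_summable_on_complete) auto
  then show ?thesis using assms(1) by simp
qed

section \<open>Distance as a natural number in a connected graph\<close>

locale connected_locally_finite_graph = locally_finite_graph +
  assumes connected: "Digraph_Component.connected (with_proj G)"
begin

text \<open>Connectedness guarantees that the minimum exists. Working in \<open>nat\<close> rather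
  than \<open>ereal\<close> allows distances to be split additively.\<close>

definition hops :: "'a \<Rightarrow> 'a \<Rightarrow> nat" where
  "hops x y = (LEAST n. \<exists>w. awalk x w y \<and> length w = n)"

lemma shortest_awalk:
  assumes "x \<in> pverts G" "y \<in> pverts G"
  obtains w where "awalk x w y" "length w = hops x y"
proof -
  have "strongly_connected (with_proj G)"
    using symmetric_connected_imp_strongly_connected[OF sym_arcs connected] .
  then have "x \<rightarrow>\<^sup>*\<^bsub>with_proj G\<^esub> y" using assms by (simp add: strongly_connected_def)
  then obtain w where "awalk x w y" by (auto simp: reachable_awalk)
  then have "\<exists>n. \<exists>w. awalk x w y \<and> length w = n" by blast
  from LeastI_ex[OF this] show ?thesis using that unfolding hops_def by blast
qed

lemma hops_le: "awalk x w y \<Longrightarrow> hops x y \<le> length w"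
  unfolding hops_def by (rule Least_le) blast

text \<open>All arcs have unit cost, so a shortest walk attains the infimum behind
  \<open>graph_dist\<close>.\<close>

lemma graph_dist_eq_hops:
  assumes "x \<in> pverts G" "y \<in> pverts G"
  shows "graph_dist G x y = ereal (real (hops x y))"
proof -
  have cost: "awalk_cost (\<lambda>_. 1) w = real (length w)" for w :: "('a \<times> 'a) list"
    by (induction w) auto
  obtain w where w: "awalk x w y" "length w = hops x y"
    using shortest_awalk[OF assms] .
  show ?thesis unfolding graph_dist_def \<mu>_def cost
  proof (rule antisym)
    show "(INF w\<in>{w. awalk x w y}. ereal (real (length w))) \<le> ereal (real (hops x y))"
      by (rule INF_lower2[of w]) (use w in auto)
  qed (rule INF_greatest, use hops_le in auto)
qed

lemma hops_self: "x \<in> pverts G \<Longrightarrow> hops x x = 0"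
  using hops_le[of x "[]" x] by (simp add: awalk_Nil_iff)

lemma hops_triangle:
  assumes "x \<in> pverts G" "y \<in> pverts G" "z \<in> pverts G"
  shows "hops x z \<le> hops x y + hops y z"
proof -
  obtain v w where "awalk x v y" "length v = hops x y" "awalk y w z" "length w = hops y z"
    using shortest_awalk assms by metis
  then show ?thesis using hops_le[of x "v @ w" z] awalk_appendI[of x v y w z] by simp
qed

lemma awalk_reverse: "awalk x w y \<Longrightarrow> \<exists>v. awalk y v x \<and> length v = length w"
proof (induction w arbitrary: x)
  case Nil
  then show ?case by (intro exI[of _ "[]"]) (auto simp: awalk_Nil_iff)
next
  case (Cons e w)
  obtain z where e: "e = (x, z)" "(x, z) \<in> parcs G" and w: "awalk z w y"
    using Cons.prems by (cases e) (auto simp: awalk_Cons_iff)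
  obtain v where v: "awalk y v z" "length v = length w" using Cons.IH[OF w] by blast
  have "(z, x) \<in> parcs G" using e(2) by (simp add: arcs_symmetric)
  then have "awalk z [(z, x)] x" using arc_implies_awalk[of "(z, x)"] by simp
  then show ?case using v by (intro exI[of _ "v @ [(z, x)]"]) (auto intro: awalk_appendI)
qed

lemma hops_commute:
  assumes "x \<in> pverts G" "y \<in> pverts G"
  shows "hops x y = hops y x"
proof -
  have "hops u v \<le> hops v u" if "u \<in> pverts G" "v \<in> pverts G" for u v
    using shortest_awalk[OF that(2,1)] awalk_reverse hops_le by metis
  then show ?thesis using assms by (simp add: antisym)
qed

text \<open>Cutting a shortest walk after \<open>m\<close> arcs gives pieces that bound the two
  distances from above; the triangle inequality forces equality in both.\<close>

lemma hops_split:
  assumes "x \<in> pverts G" "y \<in> pverts G" "hops x y = m + n"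
  obtains z where "z \<in> pverts G" "hops x z = m" "hops z y = n"
proof -
  obtain w where w: "awalk x w y" "length w = m + n"
    using shortest_awalk[OF assms(1,2)] assms(3) by metis
  have "awalk x (take m w @ drop m w) y" using w by simp
  then obtain z where z: "awalk x (take m w) z" "awalk z (drop m w) y"
    unfolding awalk_append_iff by blast
  have zV: "z \<in> pverts G" using awalk_last_in_verts[OF z(1)] by simp
  have "hops x z \<le> m" "hops z y \<le> n" using hops_le[OF z(1)] hops_le[OF z(2)] w(2) by auto
  moreover have "m + n \<le> hops x z + hops z y"
    using hops_triangle[OF assms(1) zV assms(2)] assms(3) by simp
  ultimately show ?thesis using that zV by auto
qed

section \<open>Finiteness of balls\<close>

lemma finite_neighbours:
  assumes "x \<in> pverts G"
  shows "finite {y. (x, y) \<in> parcs G}"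
proof -
  have "{y. (x, y) \<in> parcs G} = snd ` out_arcs (with_proj G) x"
    by (force simp: out_arcs_def)
  then show ?thesis using finite_out_arcs[OF assms] by simp
qed

lemma hops_1_adjacent:
  assumes "x \<in> pverts G" "y \<in> pverts G" "hops x y = 1"
  shows "(x, y) \<in> parcs G"
proof -
  obtain w where "awalk x w y" "length w = 1" using shortest_awalk assms by metis
  then show ?thesis
    by (cases w) (auto simp: awalk_Cons_iff awalk_Nil_iff)
qed

text \<open>Every vertex on the sphere of radius \<open>Suc n\<close> is adjacent to one on the
  sphere of radius \<open>n\<close>, and a finite set of vertices has only finitely many
  neighbours.\<close>

lemma finite_sphere:
  assumes x: "x \<in> pverts G"
  shows "finite {y \<in> pverts G. hops x y = n}"
proof (induction n)
  case 0
  have "y = x" if "y \<in> pverts G" "hops x y = 0" for y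
    using shortest_awalk[OF x that(1)] that(2) by (metis awalk_empty_ends length_0_conv)
  then have "{y \<in> pverts G. hops x y = 0} \<subseteq> {x}" by blast
  then show ?case using finite_subset by blast
next
  case (Suc n)
  let ?S = "{y \<in> pverts G. hops x y = n}"
  have "{y \<in> pverts G. hops x y = Suc n} \<subseteq> (\<Union>z\<in>?S. {y. (z, y) \<in> parcs G})"
  proof
    fix y assume "y \<in> {y \<in> pverts G. hops x y = Suc n}"
    then have y: "y \<in> pverts G" "hops x y = n + 1" by auto
    obtain z where "z \<in> pverts G" "hops x z = n" "hops z y = 1"
      using hops_split[OF x y] .
    then show "y \<in> (\<Union>z\<in>?S. {y. (z, y) \<in> parcs G})" using y hops_1_adjacent by blast
  qed
  moreover have "finite (\<Union>z\<in>?S. {y. (z, y) \<in> parcs G})"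
    using Suc.IH finite_neighbours by blast
  ultimately show ?case by (rule finite_subset)
qed

lemma finite_pverts_if_bounded:
  assumes x: "x \<in> pverts G" and "\<And>y. y \<in> pverts G \<Longrightarrow> hops x y \<le> n"
  shows "finite (pverts G)"
proof -
  have "pverts G = (\<Union>i\<in>{..n}. {y \<in> pverts G. hops x y = i})" using assms(2) by auto
  also have "finite \<dots>" using finite_sphere[OF x] by blast
  finally show ?thesis .
qed

section \<open>The easy half of Kantorovich duality\<close>

text \<open>Against any plan, the difference of expectations is the sum of
  \<open>(f x - f y) * \<pi> x y\<close>, which the transport cost dominates. The finite set
  \<open>S\<close> containing both supports turns everything but the cost itself into finite sums,
  so integrability of \<open>f\<close> is no issue.\<close>

lemma expectation_diff_le_W1:
  fixes f :: "'a \<Rightarrow> real"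
  assumes S: "finite S" "S \<subseteq> pverts G" "set_pmf \<mu>1 \<subseteq> S" "set_pmf \<mu>2 \<subseteq> S"
    and f: "\<And>u v. u \<in> pverts G \<Longrightarrow> v \<in> pverts G \<Longrightarrow> f u - f v \<le> real (hops u v)"
  shows "ereal (measure_pmf.expectation \<mu>1 f - measure_pmf.expectation \<mu>2 f) \<le> W1 G \<mu>1 \<mu>2"
proof -
  let ?E1 = "measure_pmf.expectation \<mu>1 f" and ?E2 = "measure_pmf.expectation \<mu>2 f"
  let ?V = "pverts G"
  have bound: "ennreal (?E1 - ?E2) \<le>
      (\<Sum>\<^sub>\<infinity>y\<in>?V. \<Sum>\<^sub>\<infinity>x\<in>?V. e2ennreal (graph_dist G x y) * ennreal (\<pi> x y))"
    if \<pi>: "\<pi> \<in> transport_plans ?V \<mu>1 \<mu>2" for \<pi>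
  proof -
    have pos: "0 \<le> \<pi> x y" if "x \<in> ?V" "y \<in> ?V" for x y
      using \<pi> that by (auto simp: transport_plans_def)
    have row: "((\<lambda>y. \<pi> x y) has_sum pmf \<mu>1 x) ?V" if "x \<in> ?V" for x
      using \<pi> that by (auto simp: transport_plans_def)
    have col: "((\<lambda>x. \<pi> x y) has_sum pmf \<mu>2 y) ?V" if "y \<in> ?V" for y
      using \<pi> that by (auto simp: transport_plans_def)
    \<comment> \<open>An entry is at most its row sum and at most its column sum, and one of these
      vanishes when \<open>x\<close> or \<open>y\<close> lies outside the supports.\<close>
    have zero: "\<pi> x y = 0" if "x \<in> ?V" "y \<in> ?V" "x \<notin> S \<or> y \<notin> S" for x y
    proof -
      have "\<pi> x y \<le> pmf \<mu>1 x"
        using finite_sum_le_has_sum[OF row[OF that(1)], of "{y}"] pos that by auto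
      moreover have "\<pi> x y \<le> pmf \<mu>2 y"
        using finite_sum_le_has_sum[OF col[OF that(2)], of "{x}"] pos that by auto
      moreover have "pmf \<mu>1 x = 0 \<or> pmf \<mu>2 y = 0" using that(3) S by (auto simp: pmf_eq_0_set_pmf)
      ultimately show ?thesis using pos[OF that(1,2)] by linarith
    qed
    have row': "pmf \<mu>1 x = (\<Sum>y\<in>S. \<pi> x y)" if "x \<in> S" for x
    proof -
      have "x \<in> ?V" using that S by blast
      from row[OF this] have "((\<lambda>y. \<pi> x y) has_sum pmf \<mu>1 x) S"
        by (subst has_sum_cong_neutral[where g = "\<pi> x" and T = ?V])
          (use S zero \<open>x \<in> ?V\<close> in auto)
      then show ?thesis using S(1) by (simp add: has_sum_finite_iff)
    qed
    have col': "pmf \<mu>2 y = (\<Sum>x\<in>S. \<pi> x y)" if "y \<in> S" for y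
    proof -
      have "y \<in> ?V" using that S by blast
      from col[OF this] have "((\<lambda>x. \<pi> x y) has_sum pmf \<mu>2 y) S"
        by (subst has_sum_cong_neutral[where g = "\<lambda>x. \<pi> x y" and T = ?V])
          (use S zero \<open>y \<in> ?V\<close> in auto)
      then show ?thesis using S(1) by (simp add: has_sum_finite_iff)
    qed
    have "?E1 = (\<Sum>x\<in>S. f x * pmf \<mu>1 x)"
      by (rule integral_measure_pmf_real) (use S in auto)
    also have "\<dots> = (\<Sum>x\<in>S. \<Sum>y\<in>S. f x * \<pi> x y)"
      by (simp add: row' sum_distrib_left)
    also have "\<dots> = (\<Sum>y\<in>S. \<Sum>x\<in>S. f x * \<pi> x y)"
      by (rule sum.swap)
    finally have E1: "?E1 = (\<Sum>y\<in>S. \<Sum>x\<in>S. f x * \<pi> x y)" .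
    have "?E2 = (\<Sum>y\<in>S. f y * pmf \<mu>2 y)"
      by (rule integral_measure_pmf_real) (use S in auto)
    also have "\<dots> = (\<Sum>y\<in>S. \<Sum>x\<in>S. f y * \<pi> x y)"
      by (simp add: col' sum_distrib_left)
    finally have "?E1 - ?E2 = (\<Sum>y\<in>S. \<Sum>x\<in>S. (f x - f y) * \<pi> x y)"
      unfolding E1 by (simp add: sum_subtractf left_diff_distrib)
    also have "\<dots> \<le> (\<Sum>y\<in>S. \<Sum>x\<in>S. real (hops x y) * \<pi> x y)"
      by (intro sum_mono mult_right_mono f pos) (use S in auto)
    finally have "ennreal (?E1 - ?E2) \<le> ennreal (\<Sum>y\<in>S. \<Sum>x\<in>S. real (hops x y) * \<pi> x y)"
      by (rule ennreal_leI)
    also have "\<dots> = (\<Sum>y\<in>S. \<Sum>x\<in>S. ennreal (real (hops x y) * \<pi> x y))"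
      using S(2) pos by (simp add: sum_nonneg subset_iff flip: sum_ennreal)
    also have "\<dots> = (\<Sum>y\<in>S. \<Sum>x\<in>S. e2ennreal (graph_dist G x y) * ennreal (\<pi> x y))"
      using S(2) pos
      by (intro sum.cong refl)
        (auto simp: graph_dist_eq_hops subset_iff e2ennreal_ereal ennreal_mult)
    also have "\<dots> \<le> (\<Sum>y\<in>S. \<Sum>\<^sub>\<infinity>x\<in>?V. e2ennreal (graph_dist G x y) * ennreal (\<pi> x y))"
      by (intro sum_mono sum_le_infsum_ennreal S)
    also have "\<dots> \<le> (\<Sum>\<^sub>\<infinity>y\<in>?V. \<Sum>\<^sub>\<infinity>x\<in>?V. e2ennreal (graph_dist G x y) * ennreal (\<pi> x y))"
      by (intro sum_le_infsum_ennreal S)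
    finally show ?thesis .
  qed
  \<comment> \<open>\<open>ennreal\<close> sends negative reals to 0, so a negative difference only
    increases here.\<close>
  have "ereal (?E1 - ?E2) \<le> enn2ereal (ennreal (?E1 - ?E2))"
    by (cases "0 \<le> ?E1 - ?E2") (auto simp: enn2ereal_ennreal ennreal_neg zero_ennreal.rep_eq)
  also have "\<dots> \<le> W1 G \<mu>1 \<mu>2"
    unfolding W1_def by (rule less_eq_ennreal.rep_eq[THEN iffD1]) (rule INF_greatest, rule bound)
  finally show ?thesis .
qed

section \<open>Expectations along a geodesic\<close>

lemma lazy_step_1: "x \<in> pverts G \<Longrightarrow> lazy_step G 1 x = return_pmf x"
  by (rule pmf_eqI) (simp add: pmf_lazy_step pmf_return)

lemma
  assumes "x \<in> pverts G" "0 \<le> \<epsilon>" "\<epsilon> \<le> 1"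
  shows finite_set_pmf_lazy_step: "finite (set_pmf (lazy_step G \<epsilon> x))"
    and set_pmf_lazy_step_subset: "set_pmf (lazy_step G \<epsilon> x) \<subseteq> pverts G"
proof -
  have *: "set_pmf (lazy_step G \<epsilon> x) \<subseteq> insert x {y. (x, y) \<in> parcs G}"
    using assms by (auto simp: set_pmf_iff pmf_lazy_step split: if_splits)
  then show "finite (set_pmf (lazy_step G \<epsilon> x))"
    using finite_neighbours[OF assms(1)] finite_subset by blast
  show "set_pmf (lazy_step G \<epsilon> x) \<subseteq> pverts G"
    using * assms(1) in_arcsD2 by blast
qed

text \<open>Two separate laziness parameters let this serve both curvature hypotheses: \<epsilon>
  against \<epsilon>, and 1 against \<epsilon>.\<close>

lemma expectation_lazy_step_diff_le:
  fixes f :: "'a \<Rightarrow> real"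
  assumes "x \<in> pverts G" "y \<in> pverts G" "0 \<le> \<epsilon>" "\<epsilon> \<le> 1" "0 \<le> \<delta>" "\<delta> \<le> 1"
    and "\<And>u v. u \<in> pverts G \<Longrightarrow> v \<in> pverts G \<Longrightarrow> f u - f v \<le> real (hops u v)"
    and W1: "W1 G (lazy_step G \<epsilon> x) (lazy_step G \<delta> y) \<le> ereal c"
  shows "measure_pmf.expectation (lazy_step G \<epsilon> x) f -
         measure_pmf.expectation (lazy_step G \<delta> y) f \<le> c"
proof -
  have "ereal (measure_pmf.expectation (lazy_step G \<epsilon> x) f -
      measure_pmf.expectation (lazy_step G \<delta> y) f) \<le> W1 G (lazy_step G \<epsilon> x) (lazy_step G \<delta> y)"
    by (rule expectation_diff_le_W1[of "set_pmf (lazy_step G \<epsilon> x) \<union> set_pmf (lazy_step G \<delta> y)"])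
      (use assms finite_set_pmf_lazy_step set_pmf_lazy_step_subset in auto)
  also note W1
  finally show ?thesis by simp
qed

text \<open>Induction peels off the first piece of length \<open>q\<close> of a geodesic; distance 0
  forces \<open>u = v\<close> and the difference vanishes.\<close>

lemma expectation_telescope:
  fixes f :: "'a \<Rightarrow> real"
  assumes \<epsilon>: "0 \<le> \<epsilon>" "\<epsilon> \<le> 1"
    and f: "\<And>u v. u \<in> pverts G \<Longrightarrow> v \<in> pverts G \<Longrightarrow> f u - f v \<le> real (hops u v)"
    and W1: "\<And>x y. x \<in> pverts G \<Longrightarrow> y \<in> pverts G \<Longrightarrow> hops x y = q \<Longrightarrow>
           W1 G (lazy_step G \<epsilon> x) (lazy_step G \<epsilon> y) \<le> ereal c"
    and "u \<in> pverts G" "v \<in> pverts G" "hops u v = n * q"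
  shows "measure_pmf.expectation (lazy_step G \<epsilon> u) f -
         measure_pmf.expectation (lazy_step G \<epsilon> v) f \<le> real n * c"
  using assms(5-)
proof (induction n arbitrary: u)
  case 0
  then obtain w where "awalk u w v" "length w = 0" using shortest_awalk[of u v] by auto
  then have "u = v" by (simp add: awalk_Nil_iff)
  then show ?case by simp
next
  case (Suc n)
  have "hops u v = q + n * q" using Suc.prems by simp
  then obtain z where z: "z \<in> pverts G" "hops u z = q" "hops z v = n * q"
    using hops_split[OF Suc.prems(1,2)] by metis
  have "measure_pmf.expectation (lazy_step G \<epsilon> u) f -
      measure_pmf.expectation (lazy_step G \<epsilon> z) f \<le> c"
    by (rule expectation_lazy_step_diff_le) (use Suc.prems z \<epsilon> f W1 in auto)
  moreover note Suc.IH[OF z(1) Suc.prems(2) z(3)]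
  ultimately show ?case by (simp add: algebra_simps)
qed

lemma contraction_at_distance:
  assumes \<epsilon>: "0 \<le> \<epsilon>" "\<epsilon> \<le> 1"
    and q: "\<And>x y. x \<in> pverts G \<Longrightarrow> y \<in> pverts G \<Longrightarrow> hops x y = q \<Longrightarrow>
           W1 G (lazy_step G \<epsilon> x) (lazy_step G \<epsilon> y) \<le> ereal (real q - C1)"
    and p: "\<And>x y. x \<in> pverts G \<Longrightarrow> y \<in> pverts G \<Longrightarrow> hops x y = p \<Longrightarrow>
           W1 G (lazy_step G 1 x) (lazy_step G \<epsilon> y) \<le> ereal (real p + C2)"
    and x: "x \<in> pverts G" and y: "y \<in> pverts G" and xy: "hops x y = 2 * p + n * q"
  shows "real n * C1 \<le> 2 * C2"
proof -
  define f where "f v = real (hops y v)" for v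
  \<comment> \<open>The hypothesis for distance \<open>p\<close> has the Dirac measure first. At the
    end \<open>y\<close> the difference is needed in the opposite order, which negating the test
    function provides.\<close>
  define g where "g v = - f v" for v
  have f: "f u - f v \<le> real (hops u v)" if "u \<in> pverts G" "v \<in> pverts G" for u v
    using hops_triangle[OF y that(2,1)] hops_commute[OF that] by (simp add: f_def)
  have g: "g u - g v \<le> real (hops u v)" if "u \<in> pverts G" "v \<in> pverts G" for u v
    using f[OF that(2,1)] hops_commute[OF that] by (simp add: g_def)
  have "hops x y = p + (n * q + p)" using xy by simp
  then obtain u where u: "u \<in> pverts G" "hops x u = p" "hops u y = n * q + p"
    using hops_split[OF x y] by metis
  obtain v where v: "v \<in> pverts G" "hops u v = n * q" "hops v y = p"
    using hops_split[OF u(1) y u(3)] .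
  have "measure_pmf.expectation (lazy_step G 1 x) f -
      measure_pmf.expectation (lazy_step G \<epsilon> u) f \<le> real p + C2"
    by (rule expectation_lazy_step_diff_le) (use x u \<epsilon> f p in auto)
  moreover have "measure_pmf.expectation (lazy_step G \<epsilon> u) f -
      measure_pmf.expectation (lazy_step G \<epsilon> v) f \<le> real n * (real q - C1)"
    by (rule expectation_telescope) (use u v \<epsilon> f q in auto)
  moreover have "measure_pmf.expectation (lazy_step G 1 y) g -
      measure_pmf.expectation (lazy_step G \<epsilon> v) g \<le> real p + C2"
    by (rule expectation_lazy_step_diff_le) (use y v \<epsilon> g p hops_commute[OF v(1) y] in auto)
  \<comment> \<open>The three estimates add up; the intermediate expectations cancel and those of
    the Dirac measures are values of \<open>f\<close>.\<close>
  ultimately have "f x - f y \<le> 2 * (real p + C2) + real n * (real q - C1)"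
    using x y by (simp add: lazy_step_1 g_def[abs_def] algebra_simps)
  moreover have "f x - f y = 2 * real p + real n * real q"
    using xy hops_commute[OF x y] hops_self[OF y] by (simp add: f_def)
  ultimately show ?thesis by (simp add: algebra_simps)
qed

end

section \<open>The diameter bound\<close>

theorem theorem3p2:
  fixes G :: "'a pair_pre_digraph" and \<epsilon> C1 C2 :: real and p q :: nat
  assumes "locally_finite_graph G"
    and "Digraph_Component.connected (with_proj G)"
    and "0 \<le> \<epsilon>" and "\<epsilon> < 1"
    and "q > 0"
    and "C1 > 0"
    and "\<And>x y. x \<in> pverts G \<Longrightarrow> y \<in> pverts G \<Longrightarrow> graph_dist G x y = ereal (real q) \<Longrightarrow>
           W1 G (lazy_step G \<epsilon> x) (lazy_step G \<epsilon> y) \<le> ereal (real q - C1)"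
    and "\<And>x y. x \<in> pverts G \<Longrightarrow> y \<in> pverts G \<Longrightarrow> graph_dist G x y = ereal (real p) \<Longrightarrow>
           W1 G (lazy_step G 1 x) (lazy_step G \<epsilon> y) \<le> ereal (real p + C2)"
  shows "finite (pverts G) \<and>
         graph_diameter G \<le>
           ereal (real_of_int (2 * int p - 1 + max 0 ((\<lfloor>2 * C2 / C1\<rfloor> + 1) * int q)))"
proof -
  interpret locally_finite_graph G by fact
  interpret connected_locally_finite_graph G by unfold_locales fact
  \<comment> \<open>This is the least natural number above \<open>2 * C2 / C1\<close>; the
    truncation by \<open>nat\<close> accounts for the maximum with 0 in the bound.\<close>
  define n where "n = nat (\<lfloor>2 * C2 / C1\<rfloor> + 1)"
  define D where "D = 2 * p + n * q"
  have "2 * C2 / C1 < real n" unfolding n_def by linarith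
  then have n: "2 * C2 < real n * C1" using \<open>C1 > 0\<close> by (simp add: field_simps)
  have no_D: "hops x y \<noteq> D" if "x \<in> pverts G" "y \<in> pverts G" for x y
  proof
    assume "hops x y = D"
    then have "real n * C1 \<le> 2 * C2"
      using that assms(3,4,7,8) unfolding D_def
      by (intro contraction_at_distance[of \<epsilon> q C1 p C2 x y n]) (auto simp: graph_dist_eq_hops)
    then show False using n by simp
  qed
  have less_D: "hops x y < D" if xy: "x \<in> pverts G" "y \<in> pverts G" for x y
  proof (rule ccontr)
    assume "\<not> hops x y < D"
    then have "hops x y = D + (hops x y - D)" by simp
    then obtain z where "z \<in> pverts G" "hops x z = D" using hops_split[OF xy] by metis
    then show False using no_D xy by blast
  qed
  \<comment> \<open>Connectedness includes that there is at least one vertex.\<close>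
  obtain x where x: "x \<in> pverts G"
    using connected by (auto simp: connected_def strongly_connected_def)
  have fin: "finite (pverts G)"
    using finite_pverts_if_bounded[OF x, of D] less_D[OF x] by (simp add: less_imp_le)
  \<comment> \<open>As \<open>q\<close> is positive, the product has the sign of its first factor,
    so the maximum with 0 can be taken before or after multiplying.\<close>
  have "int n * int q = max 0 ((\<lfloor>2 * C2 / C1\<rfloor> + 1) * int q)"
    using \<open>q > 0\<close> by (auto simp: n_def max_def zero_le_mult_iff)
  then have bound: "2 * int p - 1 + max 0 ((\<lfloor>2 * C2 / C1\<rfloor> + 1) * int q) = int D - 1"
    by (simp add: D_def)
  \<comment> \<open>The summand -1 comes from a strict inequality between integers.\<close>
  have "graph_dist G x y \<le> ereal (real_of_int (int D - 1))"
    if "x \<in> pverts G" "y \<in> pverts G" for x y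
    using less_D[OF that] by (simp add: graph_dist_eq_hops[OF that])
  then have "graph_diameter G \<le> ereal (real_of_int (int D - 1))"
    unfolding graph_diameter_def by (intro SUP_least)
  then show ?thesis using fin unfolding bound by blast
qed

end
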